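(* Let $X$ be a random variable of type $\mathscr{L}'$. Then for all even integers $2 \leq p \leq q$, we have $$\|X\|_q \leq \frac{\|G\|_q}{\|G\|_p}\,\|X\|_p,$$ where $G$ is a standard Gaussian random variable.
   Context: A real-valued random variable $X$ is of type $\mathscr{L}'$ if (i) there are positive constants $C, C'$ such that $|\mathbb{E}\exp(zX)| \leq C\exp(C'|z|^2)$ for all $z \in \mathbb{C}$, and (ii') the function $z \mapsto \mathbb{E}\exp(zX)$ on $\mathbb{C}$ has only pure imaginary zeros (it may have no zeros at all). For a real random variable $Y$, $\|Y\|_p = (\mathbb{E}|Y|^p)^{1/p}$. *)

theory Defs
  imports "HOL-Probability.Probability"
begin

definition complex_mgf :: "'a measure \<Rightarrow> ('a \<Rightarrow> real) \<Rightarrow> complex \<Rightarrow> complex" where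
  "complex_mgf M X z = (LINT \<omega>|M. exp (z * complex_of_real (X \<omega>)))"

text \<open>
  The Bochner integral of a non-integrable function is \<open>0\<close>, so the existence of the
  expectation, implicit in the growth condition, has to be demanded explicitly.
\<close>

definition type_L' :: "'a measure \<Rightarrow> ('a \<Rightarrow> real) \<Rightarrow> bool" where
  "type_L' M X \<longleftrightarrow>
     X \<in> borel_measurable M \<and>
     (\<forall>z. integrable M (\<lambda>\<omega>. exp (z * complex_of_real (X \<omega>)))) \<and>
     (\<exists>C C' :: real. C > 0 \<and> C' > 0 \<and>
        (\<forall>z. cmod (complex_mgf M X z) \<le> C * exp (C' * (cmod z)\<^sup>2))) \<and>
     (\<forall>z. complex_mgf M X z = 0 \<longrightarrow> Re z = 0)"

text \<open>
  Meaningful for \<open>p > 0\<close> and \<open>p\<close>-integrable \<open>Y\<close> only; a variable of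
  type \<open>\<L>'\<close> and a Gaussian one have finite absolute moments of all orders.
\<close>

definition Lp_norm :: "'a measure \<Rightarrow> real \<Rightarrow> ('a \<Rightarrow> real) \<Rightarrow> real" where
  "Lp_norm M p Y = (LINT \<omega>|M. \<bar>Y \<omega>\<bar> powr p) powr (1 / p)"

end

theory Submission
  imports Defs "HOL-Complex_Analysis.Complex_Analysis" "HOL-Real_Asymp.Real_Asymp"
begin

text \<open>
  Let \<open>f z = E exp (z X)\<close>, \<open>b = E X\<close> and \<open>c k = k! E X\<^sup>2\<^sup>k / (2 k)!\<close>. Since the \<open>2 k\<close>-th moment of
  \<open>G\<close> is \<open>(2 k)! / (2\<^sup>k k!)\<close>, the number \<open>2\<^sup>k c k\<close> is the quotient of the \<open>2 k\<close>-th moments of \<open>X\<close> and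
  \<open>G\<close>, and the claim says that \<open>c k powr (1 / k)\<close> is nonincreasing in \<open>k \<ge> 1\<close>. As \<open>c 0 = 1\<close>, this follows once
  \<open>c\<close> is log-concave.

  The number \<open>c k\<close> is \<open>k!\<close> times the \<open>2 k\<close>-th Taylor coefficient of \<open>f\<close>. For
  \<open>f z = exp (b z)\<close> the sequence \<open>c\<close> is log-concave by inspection, and multiplying \<open>f\<close> by \<open>1 + x z\<^sup>2\<close> with
  \<open>x \<ge> 0\<close> preserves log-concavity (Newton's inequalities for real-rooted polynomials, in the limit of
  infinite degree; see \<open>strongly_log_concave_linear_factor\<close>). So it suffices to approximate \<open>f\<close>,
  uniformly on the unit circle, by products of \<open>exp (b z)\<close> and finitely many factors
  \<open>1 + x z\<^sup>2\<close>, \<open>x \<ge> 0\<close>.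

  This is Hadamard factorisation in a finite form. The zeros of \<open>f\<close> are imaginary
  and come in conjugate pairs \<open>\<plusminus>i t\<close>, and such a pair is the zero set of \<open>1 + z\<^sup>2 / t\<^sup>2\<close>. Divide \<open>f\<close> by these
  factors for all zeros of modulus at most \<open>R\<close>. By the maximum principle the cofactor is bounded
  by \<open>exp (O(R\<^sup>2))\<close> on the disc of radius \<open>R\<close>, where it has a holomorphic logarithm. The
  Borel-Caratheodory inequality turns the bound on the real part of the logarithm into one on its
  modulus, so all its Taylor coefficients of order at least three tend to \<open>0\<close> as \<open>R \<rightarrow> \<infinity>\<close>
  (\<open>finite_factorization\<close>). The linear coefficient is \<open>b\<close>, and the quadratic one is
  \<open>v - \<Sum>x\<close>, with \<open>v\<close> half the variance of \<open>X\<close> and the sum over the factors taken out.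

  The remaining point is that \<open>v - \<Sum>x \<ge> 0\<close>, for only then is \<open>exp ((v - \<Sum>x) z\<^sup>2)\<close> itself a limit of powers
  of factors \<open>1 + x z\<^sup>2\<close> with \<open>x \<ge> 0\<close>. This comes from Jensen's inequality:
  \<open>f s \<ge> exp (b s)\<close> on the real axis, and a Gaussian factor with negative exponent would violate this, because it
  decays faster than finitely many factors \<open>1 + x s\<^sup>2\<close> grow (\<open>sum_list_le_half_variance\<close>).
\<close>

section \<open>Log-concave sequences\<close>

text \<open>
  For positive sequences the case \<open>i = j\<close> implies the others. With zeros allowed it does not, and the
  general inequality is the one that survives multiplication by a linear factor. Zeros do occur, for instance
  in the sequence of a finite product of factors \<open>1 + x w\<close>.
\<close>

definition strongly_log_concave :: "(nat \<Rightarrow> real) \<Rightarrow> bool" where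
  "strongly_log_concave c \<longleftrightarrow>
     (\<forall>k. 0 \<le> c k) \<and> (\<forall>i j. i \<le> j \<longrightarrow> c i * c (Suc (Suc j)) \<le> c (Suc i) * c (Suc j))"

lemma strongly_log_concaveD:
  assumes "strongly_log_concave c"
  shows "0 \<le> c k" "i \<le> j \<Longrightarrow> c i * c (Suc (Suc j)) \<le> c (Suc i) * c (Suc j)"
  using assms by (auto simp: strongly_log_concave_def)

text \<open>
  If \<open>c k = k! a k\<close>, the new sequence belongs to the power series \<open>(1 + x w) \<Sum> a k w\<^sup>k\<close>. The defect of
  log-concavity is a quadratic polynomial in \<open>x\<close>, and each of its coefficients is nonnegative by
  log-concavity of \<open>c\<close> at suitable indices. At index \<open>0\<close> the truncated
  \<open>k - 1\<close> is harmless because of the factor \<open>k\<close>.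
\<close>
lemma strongly_log_concave_linear_factor:
  fixes x :: real
  assumes c: "strongly_log_concave c" and x: "0 \<le> x"
  shows "strongly_log_concave (\<lambda>k. c k + real k * x * c (k - 1))"
  unfolding strongly_log_concave_def
proof (intro conjI allI impI)
  note nn = strongly_log_concaveD(1)[OF c] and lc = strongly_log_concaveD(2)[OF c]
  show "0 \<le> c k + real k * x * c (k - 1)" for k
    using nn x by simp
  fix i j :: nat
  assume ij: "i \<le> j"
  have A0: "0 \<le> c (Suc i) * c (Suc j) - c i * c (Suc (Suc j))"
    using lc[OF ij] by simp
  have A1: "0 \<le> real (j + 1) * (c (Suc i) * c j - c i * c (Suc j))"
  proof (cases "i = j")
    case False
    then obtain j' where "j = Suc j'" "i \<le> j'"
      using ij by (cases j) auto
    then show ?thesis using lc[of i j'] by simp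
  qed simp
  have A2: "0 \<le> real i * (c i * c (Suc j) - c (i - 1) * c (Suc (Suc j)))"
  proof (cases i)
    case (Suc i')
    then show ?thesis using lc[of i' j] ij by simp
  qed simp
  have A3: "0 \<le> real ((i + 1) * (j + 1)) * (c i * c j) - real (i * (j + 2)) * (c (i - 1) * c (Suc j))"
  proof (cases i)
    case 0
    then show ?thesis using nn by simp
  next
    case (Suc i')
    then obtain j' where j': "j = Suc j'" "i' \<le> j'"
      using ij by (cases j) auto
    have "real (i * (j + 2)) * (c (i - 1) * c (Suc j)) \<le> real ((i + 1) * (j + 1)) * (c i * c j)"
    proof (rule mult_mono)
      show "real (i * (j + 2)) \<le> real ((i + 1) * (j + 1))"
        unfolding of_nat_le_iff using ij by simp
      show "c (i - 1) * c (Suc j) \<le> c i * c j"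
        using lc[OF j'(2)] Suc j' by simp
    qed (use nn in auto)
    then show ?thesis by simp
  qed
  have "(c (Suc i) + real (Suc i) * x * c (Suc i - 1)) * (c (Suc j) + real (Suc j) * x * c (Suc j - 1))
      - (c i + real i * x * c (i - 1)) * (c (Suc (Suc j)) + real (Suc (Suc j)) * x * c (Suc (Suc j) - 1))
    = (c (Suc i) * c (Suc j) - c i * c (Suc (Suc j)))
      + x * (real (j + 1) * (c (Suc i) * c j - c i * c (Suc j)))
      + x * (real i * (c i * c (Suc j) - c (i - 1) * c (Suc (Suc j))))
      + x\<^sup>2 * (real ((i + 1) * (j + 1)) * (c i * c j) - real (i * (j + 2)) * (c (i - 1) * c (Suc j)))"
    by (simp add: algebra_simps power2_eq_square)
  also have "\<dots> \<ge> 0"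
    by (intro add_nonneg_nonneg mult_nonneg_nonneg A0 A1 A2 A3 x zero_le_power2)
  finally show "(c i + real i * x * c (i - 1)) * (c (Suc (Suc j)) + real (Suc (Suc j)) * x * c (Suc (Suc j) - 1))
      \<le> (c (Suc i) + real (Suc i) * x * c (Suc i - 1)) * (c (Suc j) + real (Suc j) * x * c (Suc j - 1))"
    by simp
qed

lemma strongly_log_concave_limit:
  assumes "\<And>n. strongly_log_concave (c n)" and lim: "\<And>k. (\<lambda>n. c n k) \<longlonglongrightarrow> d k"
  shows "strongly_log_concave d"
  unfolding strongly_log_concave_def
proof (intro conjI allI impI)
  show "0 \<le> d k" for k
    by (rule LIMSEQ_le_const[OF lim]) (use assms(1) in \<open>auto simp: strongly_log_concave_def\<close>)
  show "d i * d (Suc (Suc j)) \<le> d (Suc i) * d (Suc j)" if "i \<le> j" for i j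
    by (rule LIMSEQ_le[OF tendsto_mult[OF lim lim] tendsto_mult[OF lim lim]])
       (use assms(1) that in \<open>auto simp: strongly_log_concave_def\<close>)
qed

text \<open>
  The sequence of \<open>exp (b z)\<close>, or of the constant random variable \<open>b\<close>: the quotients
  \<open>b\<^sup>2 / (2 (2 k + 1))\<close> of successive terms decrease.
\<close>
lemma strongly_log_concave_even_exp:
  fixes b :: real
  shows "strongly_log_concave (\<lambda>k. fact k * (b ^ (2 * k) / fact (2 * k)))"
  unfolding strongly_log_concave_def
proof (intro conjI allI impI)
  define c :: "nat \<Rightarrow> real" where "c k = fact k * (b ^ (2 * k) / fact (2 * k))" for k
  have nn: "0 \<le> c k" for k by (simp add: c_def)
  then show "0 \<le> fact k * (b ^ (2 * k) / fact (2 * k))" for k by (simp add: c_def)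
  have step: "c (Suc k) = c k * (b\<^sup>2 / (2 * (2 * real k + 1)))" for k
  proof -
    have "fact (2 * Suc k) = (2 * real k + 2) * ((2 * real k + 1) * fact (2 * k))"
      by (simp add: algebra_simps)
    then show ?thesis
      unfolding c_def by (simp add: divide_simps power2_eq_square) (simp add: algebra_simps)
  qed
  fix i j :: nat
  assume "i \<le> j"
  then have "b\<^sup>2 / (2 * (2 * real (Suc j) + 1)) \<le> b\<^sup>2 / (2 * (2 * real i + 1))"
    by (intro divide_left_mono) auto
  then have "c i * c (Suc j) * (b\<^sup>2 / (2 * (2 * real (Suc j) + 1))) \<le> c i * c (Suc j) * (b\<^sup>2 / (2 * (2 * real i + 1)))"
    by (intro mult_left_mono mult_nonneg_nonneg nn)
  then have "c i * c (Suc (Suc j)) \<le> c (Suc i) * c (Suc j)"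
    unfolding step[of "Suc j"] step[of i] by (simp only: mult_ac)
  then show "fact i * (b ^ (2 * i) / fact (2 * i)) * (fact (Suc (Suc j)) * (b ^ (2 * Suc (Suc j)) / fact (2 * Suc (Suc j))))
    \<le> fact (Suc i) * (b ^ (2 * Suc i) / fact (2 * Suc i)) * (fact (Suc j) * (b ^ (2 * Suc j) / fact (2 * Suc j)))"
    unfolding c_def .
qed

text \<open>
  Where no term vanishes, \<open>c 0 = 1\<close> makes \<open>c k\<close> the product of the first \<open>k\<close> quotients \<open>c (i + 1) / c i\<close>, which
  decrease: the next quotient is at most their geometric mean.
\<close>
lemma strongly_log_concave_Suc_power_le:
  assumes c: "strongly_log_concave c" and c0: "c 0 = 1"
  shows "c (Suc k) ^ k \<le> c k ^ Suc k"
proof (induction k)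
  case 0
  then show ?case using c0 by simp
next
  case (Suc k)
  note nn = strongly_log_concaveD(1)[OF c]
  show ?case
  proof (cases "c (Suc k) = 0")
    case True
    have "c 0 * c (Suc (Suc k)) \<le> c (Suc 0) * c (Suc k)"
      using strongly_log_concaveD(2)[OF c, of 0 k] by simp
    then have "c (Suc (Suc k)) = 0" using True c0 nn[of "Suc (Suc k)"] by simp
    then show ?thesis using True by simp
  next
    case False
    then have pos: "c (Suc k) ^ k > 0" using nn[of "Suc k"] by simp
    have "c (Suc (Suc k)) ^ Suc k * c (Suc k) ^ k \<le> c (Suc (Suc k)) ^ Suc k * c k ^ Suc k"
      by (intro mult_left_mono Suc.IH zero_le_power nn)
    also have "\<dots> = (c k * c (Suc (Suc k))) ^ Suc k"
      by (simp only: power_mult_distrib mult_ac)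
    also have "\<dots> \<le> (c (Suc k) * c (Suc k)) ^ Suc k"
      by (intro power_mono strongly_log_concaveD(2)[OF c] mult_nonneg_nonneg nn) simp
    also have "\<dots> = c (Suc k) ^ Suc (Suc k) * c (Suc k) ^ k"
      by (simp add: power_mult_distrib)
    finally show ?thesis using pos by simp
  qed
qed

lemma strongly_log_concave_root_antimono:
  assumes c: "strongly_log_concave c" and c0: "c 0 = 1" and m: "1 \<le> m" "m \<le> n"
  shows "c n powr (1 / n) \<le> c m powr (1 / m)"
  using m(2)
proof (induction n rule: dec_induct)
  case (step n)
  note nn = strongly_log_concaveD(1)[OF c]
  have n: "0 < n" using step m by simp
  have "c (Suc n) powr (1 / Suc n) \<le> c n powr (1 / n)"
  proof (cases "c (Suc n) = 0 \<or> c n = 0")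
    case True
    have "c (Suc n) ^ n \<le> c n ^ Suc n" by (rule strongly_log_concave_Suc_power_le[OF c c0])
    then have "c (Suc n) = 0" using True nn[of "Suc n"] n
      by (metis power_eq_0_iff order_antisym zero_le_power zero_less_Suc)
    then show ?thesis by simp
  next
    case False
    then have p: "c (Suc n) > 0" "c n > 0" using nn[of "Suc n"] nn[of n] by auto
    have "real n * (1 / (real n * real (Suc n))) = 1 / real (Suc n)"
      "real (Suc n) * (1 / (real n * real (Suc n))) = 1 / real n"
      using n by (simp_all del: of_nat_Suc)
    note exps = this
    have "c (Suc n) powr (1 / Suc n) = (c (Suc n) ^ n) powr (1 / (real n * real (Suc n)))"
      using p by (simp only: powr_realpow[symmetric] powr_powr exps)
    also have "\<dots> \<le> (c n ^ Suc n) powr (1 / (real n * real (Suc n)))"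
      by (intro powr_mono2 strongly_log_concave_Suc_power_le[OF c c0]) (use p in auto)
    also have "\<dots> = c n powr (1 / n)"
      using p by (simp only: powr_realpow[symmetric] powr_powr exps)
    finally show ?thesis .
  qed
  with step.IH show ?case by linarith
qed simp

section \<open>Even products and Taylor coefficients\<close>

definition even_product :: "real list \<Rightarrow> complex \<Rightarrow> complex" where
  "even_product xs z = (\<Prod>x\<leftarrow>xs. 1 + of_real x * z\<^sup>2)"

lemma even_product_simps [simp]:
  "even_product [] z = 1"
  "even_product (x # xs) z = (1 + of_real x * z\<^sup>2) * even_product xs z"
  "even_product (xs @ ys) z = even_product xs z * even_product ys z"
  by (simp_all add: even_product_def)

definition even_product_fps :: "real list \<Rightarrow> complex fps" where
  "even_product_fps xs = (\<Prod>x\<leftarrow>xs. 1 + fps_const (of_real x) * fps_X ^ 2)"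

lemma has_fps_expansion_even_product:
  "even_product xs has_fps_expansion even_product_fps xs"
proof (induction xs)
  case Nil
  have "even_product [] = (\<lambda>z. 1)" "even_product_fps [] = 1" by (auto simp: even_product_fps_def)
  then show ?case by simp
next
  case (Cons x xs)
  have "even_product (x # xs) = (\<lambda>z. (1 + of_real x * z\<^sup>2) * even_product xs z)" by auto
  moreover have "even_product_fps (x # xs) = (1 + fps_const (of_real x) * fps_X ^ 2) * even_product_fps xs"
    by (simp add: even_product_fps_def)
  ultimately show ?case
    by (simp only:) (intro fps_expansion_intros Cons.IH)
qed

lemma even_product_holomorphic [holomorphic_intros]: "even_product xs holomorphic_on A"
proof (induction xs)
  case (Cons x xs)
  have "even_product (x # xs) = (\<lambda>z. (1 + of_real x * z\<^sup>2) * even_product xs z)" by auto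
  then show ?case using Cons.IH by (auto intro!: holomorphic_intros)
next
  case Nil
  have "even_product [] = (\<lambda>z. 1)" by auto
  then show ?case by simp
qed

lemma fps_mult_linear_even_factor_nth:
  fixes F :: "complex fps"
  shows "fps_nth ((1 + fps_const a * fps_X ^ 2) * F) n
         = fps_nth F n + (if n < 2 then 0 else a * fps_nth F (n - 2))"
  by (simp add: ring_distribs mult.assoc fps_X_power_mult_nth)

lemma even_product_fps_low_coeffs:
  "fps_nth (even_product_fps xs) 0 = 1" "fps_nth (even_product_fps xs) 1 = 0"
  "fps_nth (even_product_fps xs) 2 = of_real (sum_list xs)"
proof (induction xs)
  case (Cons x xs)
  have E: "even_product_fps (x # xs) = (1 + fps_const (of_real x) * fps_X ^ 2) * even_product_fps xs"
    by (simp add: even_product_fps_def)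
  show "fps_nth (even_product_fps (x # xs)) 0 = 1" "fps_nth (even_product_fps (x # xs)) 1 = 0"
    "fps_nth (even_product_fps (x # xs)) 2 = of_real (sum_list (x # xs))"
    unfolding E fps_mult_linear_even_factor_nth using Cons by simp_all
qed (auto simp: even_product_fps_def)

text \<open>
  An even factor does not mix the coefficients of even index with those of odd index. So the former evolve
  as under multiplication by \<open>1 + x w\<close> with \<open>w = z\<^sup>2\<close>, even though \<open>exp (b z)\<close> is not an even function.
\<close>
lemma strongly_log_concave_even_coeffs:
  fixes b :: real
  assumes "\<And>x. x \<in> set xs \<Longrightarrow> 0 \<le> x"
  shows "strongly_log_concave
           (\<lambda>k. fact k * Re (fps_nth (even_product_fps xs * fps_exp (of_real b)) (2 * k)))"
  using assms
proof (induction xs)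
  case Nil
  have "Re (fps_nth (fps_exp (of_real b)) (2 * k)) = b ^ (2 * k) / fact (2 * k)" for k
  proof -
    have "fps_nth (fps_exp (of_real b)) (2 * k) = (complex_of_real (b ^ (2 * k) / fact (2 * k)))" by simp
    then show ?thesis by (simp only: Re_complex_of_real)
  qed
  then show ?case using strongly_log_concave_even_exp[of b] by (simp add: even_product_fps_def)
next
  case (Cons x xs)
  let ?F = "even_product_fps xs * fps_exp (of_real b)"
  have E: "even_product_fps (x # xs) * fps_exp (of_real b)
           = (1 + fps_const (of_real x) * fps_X ^ 2) * ?F"
    by (simp add: even_product_fps_def mult.assoc)
  have "fact k * Re (fps_nth (even_product_fps (x # xs) * fps_exp (of_real b)) (2 * k))
      = fact k * Re (fps_nth ?F (2 * k)) + real k * x * (fact (k - 1) * Re (fps_nth ?F (2 * (k - 1))))" for k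
  proof (cases k)
    case (Suc k')
    then show ?thesis
      unfolding E fps_mult_linear_even_factor_nth by (simp add: algebra_simps)
  qed (simp add: E fps_mult_linear_even_factor_nth)
  moreover have "strongly_log_concave (\<lambda>k. fact k * Re (fps_nth ?F (2 * k))
      + real k * x * (fact (k - 1) * Re (fps_nth ?F (2 * (k - 1)))))"
    using Cons by (intro strongly_log_concave_linear_factor) auto
  ultimately show ?case by presburger
qed


lemma fps_nth_tendsto_of_uniform_limit:
  fixes g :: "nat \<Rightarrow> complex \<Rightarrow> complex"
  assumes g: "\<And>n. g n holomorphic_on UNIV" "\<And>n. g n has_fps_expansion G n"
    and f: "f holomorphic_on UNIV" "f has_fps_expansion F"
    and e: "e \<longlonglongrightarrow> 0" "\<And>n z. cmod z = 1 \<Longrightarrow> cmod (g n z - f z) \<le> e n"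
  shows "(\<lambda>n. fps_nth (G n) k) \<longlonglongrightarrow> fps_nth F k"
proof -
  have "cmod (fps_nth (G n) k - fps_nth F k) \<le> e n" for n
  proof -
    have "(\<lambda>z. g n z - f z) has_fps_expansion (G n - F)"
      by (intro fps_expansion_intros g f)
    then have "fps_nth (G n - F) k = (deriv ^^ k) (\<lambda>z. g n z - f z) 0 / fact k"
      by (rule fps_nth_fps_expansion)
    moreover have "cmod ((deriv ^^ k) (\<lambda>z. g n z - f z) 0) \<le> fact k * e n / 1 ^ k"
    proof (rule Cauchy_inequality)
      have hol: "(\<lambda>z. g n z - f z) holomorphic_on UNIV" by (intro holomorphic_intros g f)
      show "(\<lambda>z. g n z - f z) holomorphic_on ball 0 1"
        using hol by (rule holomorphic_on_subset) auto
      show "continuous_on (cball 0 1) (\<lambda>z. g n z - f z)"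
        by (rule holomorphic_on_imp_continuous_on, rule holomorphic_on_subset[OF hol]) auto
    qed (use e in auto)
    ultimately have "fact k * cmod (fps_nth (G n) k - fps_nth F k) \<le> fact k * e n"
      by (simp add: norm_divide)
    then show ?thesis by simp
  qed
  then have "(\<lambda>n. fps_nth (G n) k - fps_nth F k) \<longlonglongrightarrow> 0"
    by (intro Lim_null_comparison[OF _ e(1)]) auto
  then show ?thesis by (rule Lim_null[THEN iffD2])
qed

section \<open>Logarithms of nonvanishing functions\<close>

text \<open>
  The Borel-Caratheodory inequality at half the radius. The map \<open>u \<mapsto> u / (2 A - u)\<close> sends the half-plane
  \<open>Re u < A\<close> to the unit disc and fixes \<open>0\<close>, so the Schwarz lemma applies to its composition with \<open>\<phi>\<close>.
\<close>
lemma norm_le_of_Re_less_on_ball: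
  fixes \<phi> :: "complex \<Rightarrow> complex"
  assumes hol: "\<phi> holomorphic_on ball 0 R" and "\<phi> 0 = 0" and R: "0 < R"
    and Re: "\<And>z. z \<in> ball 0 R \<Longrightarrow> Re (\<phi> z) < A" and z: "cmod z \<le> R / 2"
  shows "cmod (\<phi> z) \<le> 2 * A"
proof -
  have A: "0 < A" using Re[of 0] R \<open>\<phi> 0 = 0\<close> by simp
  define h where "h w = \<phi> (of_real R * w) / (2 * of_real A - \<phi> (of_real R * w))" for w
  have in_ball: "of_real R * w \<in> ball 0 R" if "cmod w < 1" for w
    using that R by (simp add: norm_mult)
  have ne: "2 * of_real A - \<phi> u \<noteq> 0" if "u \<in> ball 0 R" for u
  proof
    assume "2 * of_real A - \<phi> u = 0"
    then have "\<phi> u = of_real (2 * A)" by simp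
    then have "Re (\<phi> u) = 2 * A" by (metis Re_complex_of_real)
    then show False using Re[OF that] A by simp
  qed
  have less: "cmod (\<phi> u) < cmod (2 * of_real A - \<phi> u)" if "u \<in> ball 0 R" for u
  proof -
    have "(cmod (2 * of_real A - \<phi> u))\<^sup>2 - (cmod (\<phi> u))\<^sup>2 = 4 * A * (A - Re (\<phi> u))"
      unfolding cmod_power2 by (simp add: power2_eq_square algebra_simps)
    moreover have "0 < 4 * A * (A - Re (\<phi> u))" using Re[OF that] A by simp
    ultimately have "(cmod (\<phi> u))\<^sup>2 < (cmod (2 * of_real A - \<phi> u))\<^sup>2" by linarith
    then show ?thesis by (rule power_less_imp_less_base) simp
  qed
  have "\<phi> \<circ> (\<lambda>w. of_real R * w) holomorphic_on ball 0 1"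
    by (rule holomorphic_on_compose_gen[OF _ hol]) (use in_ball in \<open>auto intro!: holomorphic_intros\<close>)
  then have "h holomorphic_on ball 0 1"
    unfolding h_def o_def using ne in_ball by (intro holomorphic_intros) auto
  moreover have "cmod (h w) < 1" if "cmod w < 1" for w
    using less[OF in_ball[OF that]] ne[OF in_ball[OF that]]
    by (simp add: h_def norm_divide divide_simps)
  moreover have "cmod (z / of_real R) < 1"
    using z R by (simp add: norm_divide divide_simps)
  moreover have "h 0 = 0" by (simp add: h_def \<open>\<phi> 0 = 0\<close>)
  ultimately have "cmod (h (z / of_real R)) \<le> cmod (z / of_real R)"
    by (intro Schwarz_Lemma(1)) auto
  also have "\<dots> \<le> 1 / 2" using z R by (simp add: norm_divide divide_simps)
  finally have "cmod (\<phi> z) / cmod (2 * of_real A - \<phi> z) \<le> 1 / 2"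
    using R by (simp add: h_def norm_divide)
  then have "2 * cmod (\<phi> z) \<le> cmod (2 * of_real A - \<phi> z)"
    using ne[of z] z R by (simp add: divide_simps split: if_splits)
  also have "\<dots> \<le> 2 * A + cmod (\<phi> z)"
    using A by (intro order_trans[OF norm_triangle_ineq4]) simp
  finally show ?thesis by simp
qed

text \<open>
  On the ball \<open>g\<close> is the exponential of some \<open>\<phi>\<close> with \<open>Re \<phi> < A\<close>, and the remainder \<open>e\<close> is that of the
  second Taylor polynomial of \<open>\<phi>\<close>. When \<open>A\<close> grows like \<open>R\<^sup>2\<close>, the factor \<open>R\<^sup>3\<close> makes the remainder vanish
  in the limit; this is where order two of growth is used.
\<close>
lemma nonvanishing_eq_exp_quadratic:
  fixes g :: "complex \<Rightarrow> complex"
  assumes hol: "g holomorphic_on UNIV" and G: "g has_fps_expansion G" and g0: "g 0 = 1"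
    and R: "0 < R" and ne: "\<And>z. z \<in> ball 0 R \<Longrightarrow> g z \<noteq> 0"
    and bound: "\<And>z. z \<in> ball 0 R \<Longrightarrow> cmod (g z) < exp A" and z: "cmod z < R / 4"
  shows "\<exists>e. g z = exp (fps_nth G 1 * z + (fps_nth G 2 - (fps_nth G 1)\<^sup>2 / 2) * z\<^sup>2 + e)
             \<and> cmod e \<le> 384 * A * cmod z ^ 3 / R ^ 3"
proof -
  have holR: "g holomorphic_on ball 0 R" using hol by (rule holomorphic_on_subset) simp
  obtain \<psi> where \<psi>: "\<psi> holomorphic_on ball 0 R" "\<And>z. z \<in> ball 0 R \<Longrightarrow> exp (\<psi> z) = g z"
    using holomorphic_logarithm_exists[of "ball 0 R" g 0] holR ne R by auto
  define \<phi> where "\<phi> u = \<psi> u - \<psi> 0" for u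
  have \<phi>: "\<phi> holomorphic_on ball 0 R" unfolding \<phi>_def by (intro holomorphic_intros \<psi>)
  have exp_\<phi>: "exp (\<phi> u) = g u" if "u \<in> ball 0 R" for u
    using \<psi>(2)[OF that] \<psi>(2)[of 0] g0 R by (simp add: \<phi>_def exp_diff)
  have "\<phi> 0 = 0" by (simp add: \<phi>_def)
  have "Re (\<phi> u) < A" if "u \<in> ball 0 R" for u
    using bound[OF that] exp_\<phi>[OF that] norm_exp_eq_Re[of "\<phi> u"] by simp
  then have bd: "cmod (\<phi> u) \<le> 2 * A" if "cmod u \<le> R / 2" for u
    using norm_le_of_Re_less_on_ball[OF \<phi> \<open>\<phi> 0 = 0\<close> R _ that] by blast
  \<comment> \<open>Comparing coefficients in \<open>g' = \<phi>' g\<close> expresses those of \<open>\<phi>\<close> through those of \<open>g\<close>.\<close>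
  define \<Phi> where "\<Phi> = fps_expansion \<phi> 0"
  have \<Phi>: "\<phi> has_fps_expansion \<Phi>"
    unfolding \<Phi>_def using \<phi> R by (intro has_fps_expansion_fps_expansion[of "ball 0 R"]) auto
  have deriv_eq: "deriv g u = deriv \<phi> u * g u" if u: "u \<in> ball 0 R" for u
  proof -
    have "(\<phi> has_field_derivative deriv \<phi> u) (at u)"
      using \<phi> u by (intro holomorphic_derivI) auto
    then have "((\<lambda>u. exp (\<phi> u)) has_field_derivative exp (\<phi> u) * deriv \<phi> u) (at u)"
      by (rule DERIV_fun_exp)
    then have "(g has_field_derivative exp (\<phi> u) * deriv \<phi> u) (at u)"
      using u exp_\<phi> by (rule has_field_derivative_transform_within_open[OF _ open_ball]) auto
    then show ?thesis using exp_\<phi>[OF u] by (simp add: DERIV_imp_deriv mult.commute)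
  qed
  have "(\<lambda>u. deriv \<phi> u * g u) has_fps_expansion fps_deriv \<Phi> * G"
    by (intro fps_expansion_intros \<Phi> G)
  moreover have "eventually (\<lambda>u. deriv \<phi> u * g u = deriv g u) (nhds 0)"
    using deriv_eq R by (intro eventually_nhds_in_open[THEN eventually_mono, of "ball 0 R"]) auto
  ultimately have "deriv g has_fps_expansion fps_deriv \<Phi> * G"
    by (simp cong: has_fps_expansion_cong)
  moreover have "deriv g has_fps_expansion fps_deriv G" by (intro fps_expansion_intros G)
  ultimately have eq: "fps_deriv \<Phi> * G = fps_deriv G" by (rule fps_expansion_unique_complex)
  have G0: "fps_nth G 0 = 1" using fps_nth_fps_expansion[OF G, of 0] g0 by simp
  have c1: "fps_nth \<Phi> 1 = fps_nth G 1"
    using arg_cong[OF eq, of "\<lambda>F. fps_nth F 0"] G0 by simp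
  have c2: "fps_nth \<Phi> 2 = fps_nth G 2 - (fps_nth G 1)\<^sup>2 / 2"
    using arg_cong[OF eq, of "\<lambda>F. fps_nth F 1"] G0 c1
    by (simp add: fps_mult_nth power2_eq_square numeral_2_eq_2 field_simps)
  let ?S = "ball (0::complex) (R / 4)"
  have "cmod ((deriv ^^ 0) \<phi> z - (\<Sum>i\<le>2. (deriv ^^ i) \<phi> 0 * (z - 0) ^ i / fact i))
      \<le> 768 * A / R ^ 3 * cmod (z - 0) ^ Suc 2 / fact 2"
  proof (rule complex_Taylor[of ?S])
    fix i :: nat and u assume u: "u \<in> ?S"
    have "(deriv ^^ i) \<phi> holomorphic_on ball 0 R" by (intro holomorphic_higher_deriv \<phi>) simp
    then have "((deriv ^^ i) \<phi> has_field_derivative (deriv ^^ Suc i) \<phi> u) (at u)"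
      using u R by (auto intro!: holomorphic_derivI[of _ "ball 0 R"])
    then show "((deriv ^^ i) \<phi> has_field_derivative (deriv ^^ Suc i) \<phi> u) (at u within ?S)"
      by (rule has_field_derivative_at_within)
    have near: "cmod v < R / 2" if "dist u v \<le> R / 4" for v
      using u that norm_triangle_ineq[of u "v - u"] by (simp add: dist_norm norm_minus_commute)
    have sub: "cball u (R / 4) \<subseteq> ball 0 R"
    proof
      fix v assume "v \<in> cball u (R / 4)"
      then show "v \<in> ball 0 R" using near[of v] R by simp
    qed
    \<comment> \<open>The ball of radius \<open>R / 4\<close> about \<open>u\<close> stays where \<open>\<phi>\<close> is bounded by \<open>2 A\<close>.\<close>
    have "cmod ((deriv ^^ 3) \<phi> u) \<le> fact 3 * (2 * A) / (R / 4) ^ 3"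
    proof (rule Cauchy_inequality)
      show "\<phi> holomorphic_on ball u (R / 4)"
        using sub ball_subset_cball by (intro holomorphic_on_subset[OF \<phi>]) blast
      show "continuous_on (cball u (R / 4)) \<phi>"
        by (intro holomorphic_on_imp_continuous_on holomorphic_on_subset[OF \<phi> sub])
      show "cmod (\<phi> v) \<le> 2 * A" if "cmod (u - v) = R / 4" for v
        using near[of v] that by (intro bd) (simp add: dist_norm)
    qed (use R in simp)
    also have "\<dots> = 768 * A / R ^ 3"
      using R by (simp add: fact_numeral field_simps)
    finally show "cmod ((deriv ^^ Suc 2) \<phi> u) \<le> 768 * A / R ^ 3"
      by (simp add: numeral_3_eq_3)
  qed (use z R in auto)
  moreover have "(\<Sum>i\<le>2. (deriv ^^ i) \<phi> 0 * (z - 0) ^ i / fact i)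
               = fps_nth \<Phi> 1 * z + fps_nth \<Phi> 2 * z\<^sup>2"
    using \<open>\<phi> 0 = 0\<close> by (simp add: fps_nth_fps_expansion[OF \<Phi>] numeral_2_eq_2)
  ultimately have err: "cmod (\<phi> z - (fps_nth \<Phi> 1 * z + fps_nth \<Phi> 2 * z\<^sup>2)) \<le> 384 * A * cmod z ^ 3 / R ^ 3"
    by simp
  have "g z = exp (fps_nth \<Phi> 1 * z + fps_nth \<Phi> 2 * z\<^sup>2 + (\<phi> z - (fps_nth \<Phi> 1 * z + fps_nth \<Phi> 2 * z\<^sup>2)))"
    using exp_\<phi>[of z] z R by simp
  with err show ?thesis unfolding c1 c2 by blast
qed


section \<open>Entire functions of order two with imaginary zeros\<close>

text \<open>
  The properties of the moment generating function that the factorisation rests on. The parameter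
  \<open>v\<close> is the quadratic coefficient of the logarithm of \<open>f\<close>, half the variance in the
  application, and the lower bound is Jensen's inequality.
\<close>
locale imaginary_zeros_entire =
  fixes f :: "complex \<Rightarrow> complex" and F :: "complex fps" and b v C K :: real
  assumes holomorphic: "f holomorphic_on UNIV"
    and expansion: "f has_fps_expansion F"
    and at_0: "f 0 = 1"
    and cnj_symmetric: "f (cnj z) = cnj (f z)"
    and growth: "cmod (f z) \<le> C * exp (K * (cmod z)\<^sup>2)"
    and C_pos: "0 < C" and K_pos: "0 < K"
    and imaginary_zeros: "f z = 0 \<Longrightarrow> Re z = 0"
    and linear_coeff: "fps_nth F 1 = of_real b"
    and quadratic_coeff: "fps_nth F 2 = of_real (v + b\<^sup>2 / 2)"
    and lower_bound: "exp (b * s) \<le> cmod (f (of_real s))"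
begin

text \<open>
  The symmetry under conjugation is kept as part of the invariant because it makes the next zero
  to be divided out again one of a conjugate pair.
\<close>
definition cofactor :: "real list \<Rightarrow> (complex \<Rightarrow> complex) \<Rightarrow> bool" where
  "cofactor xs g \<longleftrightarrow> g holomorphic_on UNIV \<and> (\<forall>z. f z = even_product xs z * g z)
     \<and> (\<forall>z. g (cnj z) = cnj (g z))"

lemma cofactor_Nil: "cofactor [] f"
  by (simp add: cofactor_def holomorphic cnj_symmetric)

lemma cofactor_at_0: "cofactor xs g \<Longrightarrow> g 0 = 1"
proof -
  assume "cofactor xs g"
  moreover have "even_product xs 0 = 1" by (induction xs) auto
  ultimately show ?thesis using at_0 by (auto simp: cofactor_def)
qed

lemma cofactor_coeffs:
  assumes g: "cofactor xs g" "g has_fps_expansion G"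
  shows "fps_nth G 1 = of_real b"
    and "fps_nth G 2 = of_real (v + b\<^sup>2 / 2 - sum_list xs)"
proof -
  have "(\<lambda>z. even_product xs z * g z) has_fps_expansion even_product_fps xs * G"
    by (intro fps_expansion_intros has_fps_expansion_even_product g)
  moreover have "(\<lambda>z. even_product xs z * g z) = f" using g by (auto simp: cofactor_def)
  ultimately have F: "even_product_fps xs * G = F"
    using expansion by (metis fps_expansion_unique_complex)
  have G0: "fps_nth G 0 = 1"
    using fps_nth_fps_expansion[OF g(2), of 0] cofactor_at_0[OF g(1)] by simp
  note P = even_product_fps_low_coeffs[of xs]
  show G1: "fps_nth G 1 = of_real b"
    using arg_cong[OF F, of "\<lambda>F. fps_nth F 1"] linear_coeff P G0 by (simp add: fps_mult_nth)
  have "fps_nth (even_product_fps xs * G) 2 = fps_nth G 2 + of_real (sum_list xs)"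
    using P G0 by (simp add: fps_mult_nth numeral_2_eq_2)
  then show "fps_nth G 2 = of_real (v + b\<^sup>2 / 2 - sum_list xs)"
    unfolding F quadratic_coeff by (simp add: algebra_simps)
qed

text \<open>
  A zero \<open>z0\<close> of \<open>g\<close> is a zero of \<open>f\<close>, hence \<open>z0 = \<plusminus>i t\<close>, and its conjugate \<open>- z0\<close> is a zero of \<open>g\<close>
  too. Removing both singularities in turn divides \<open>g\<close> by \<open>1 + z\<^sup>2 / t\<^sup>2\<close>.
\<close>
lemma cofactor_split_zero:
  assumes g: "cofactor xs g" and z0: "g z0 = 0" "cmod z0 \<le> R"
  obtains x h where "cofactor (xs @ [x]) h" "1 / R\<^sup>2 \<le> x"
proof -
  have "f z0 = 0" using g z0 by (simp add: cofactor_def)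
  then have re: "Re z0 = 0" by (rule imaginary_zeros)
  have "z0 \<noteq> 0" using z0 cofactor_at_0[OF g] by auto
  then have "Im z0 \<noteq> 0" using re by (simp add: complex_eq_iff)
  define t where "t = \<bar>Im z0\<bar>"
  have t: "0 < t" "t \<le> R" using \<open>Im z0 \<noteq> 0\<close> abs_Im_le_cmod[of z0] z0 by (auto simp: t_def)
  define a where "a = z0"
  have cnj_a: "cnj a = - a" using re by (simp add: a_def complex_eq_iff)
  have a2: "a\<^sup>2 = - of_real (t\<^sup>2)"
    using re by (simp add: a_def t_def complex_eq_iff power2_eq_square)
  have gh: "g holomorphic_on UNIV" and gc: "\<And>z. g (cnj z) = cnj (g z)"
    and fg: "\<And>z. f z = even_product xs z * g z" using g by (auto simp: cofactor_def)
  have g_na: "g (- a) = 0" using gc[of a] z0 cnj_a by (simp add: a_def)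
  define h1 where "h1 z = (if z = a then deriv g a else (g z - g a) / (z - a))" for z
  have h1: "h1 holomorphic_on UNIV" unfolding h1_def[abs_def] by (rule pole_lemma[OF gh]) simp
  have gh1: "g z = (z - a) * h1 z" for z using z0 by (simp add: h1_def a_def)
  have "a \<noteq> - a" using \<open>z0 \<noteq> 0\<close> by (simp add: a_def)
  then have h1_na: "h1 (- a) = 0" using gh1[of "- a"] g_na by auto
  define h2 where "h2 z = (if z = - a then deriv h1 (- a) else (h1 z - h1 (- a)) / (z - (- a)))" for z
  have h2: "h2 holomorphic_on UNIV" unfolding h2_def[abs_def] by (rule pole_lemma[OF h1]) simp
  have h1h2: "h1 z = (z + a) * h2 z" for z using h1_na by (simp add: h2_def add_eq_0_iff)
  define x where "x = 1 / t\<^sup>2"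
  define h where "h z = of_real (t\<^sup>2) * h2 z" for z
  have h: "h holomorphic_on UNIV" unfolding h_def by (intro holomorphic_intros h2)
  have gh': "g z = (1 + of_real x * z\<^sup>2) * h z" for z
  proof -
    have "g z = (z\<^sup>2 - a\<^sup>2) * h2 z" by (simp add: gh1 h1h2 power2_eq_square algebra_simps)
    also have "z\<^sup>2 - a\<^sup>2 = (1 + of_real x * z\<^sup>2) * of_real (t\<^sup>2)"
      using t by (simp add: a2 x_def field_simps)
    finally show ?thesis by (simp add: h_def mult.assoc)
  qed
  \<comment> \<open>Off the zeros of \<open>1 + x z\<^sup>2\<close> the symmetry of \<open>h\<close> is that of \<open>g\<close>;
     the identity theorem extends it to them.\<close>
  have "h z = cnj (h (cnj z))" for z
  proof (rule analytic_continuation_open[of "ball 0 t" UNIV h "cnj \<circ> h \<circ> cnj", unfolded o_def])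
    show "(\<lambda>z. cnj (h (cnj z))) holomorphic_on UNIV"
      using holomorphic_on_compose_cnj_cnj[of h UNIV] holomorphic_on_subset[OF h, of "cnj ` UNIV"]
      by (simp add: o_def)
    fix z :: complex assume z: "z \<in> ball 0 t"
    have "1 + of_real x * z\<^sup>2 \<noteq> 0"
    proof
      assume "1 + of_real x * z\<^sup>2 = 0"
      then have "of_real x * z\<^sup>2 = - 1" by (simp add: add_eq_0_iff)
      then have "cmod (of_real x * z\<^sup>2) = 1" by simp
      then have "x * (cmod z)\<^sup>2 = 1"
        using t by (simp only: norm_mult norm_power norm_of_real) (simp add: x_def)
      then have "(cmod z)\<^sup>2 = t\<^sup>2" using t by (simp add: x_def field_simps)
      then show False using z t by (simp add: power2_eq_iff_nonneg)
    qed
    moreover have "(1 + of_real x * z\<^sup>2) * h z = (1 + of_real x * z\<^sup>2) * cnj (h (cnj z))"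
      using gc[of "cnj z"] by (simp add: gh')
    ultimately show "h z = cnj (h (cnj z))" by simp
  qed (use h t in auto)
  then have "h (cnj z) = cnj (h z)" for z by (metis complex_cnj_cnj)
  then have "cofactor (xs @ [x]) h" using h fg gh' by (simp add: cofactor_def mult.assoc)
  moreover have "1 / R\<^sup>2 \<le> x"
    unfolding x_def using t by (intro divide_left_mono power_mono mult_pos_pos zero_less_power) auto
  ultimately show ?thesis using that by blast
qed

text \<open>
  On the circle of radius \<open>3 R\<close> each factor taken out has modulus at least \<open>9 - 1\<close>, so dividing by it
  gains a factor \<open>8\<close> there, and by the maximum principle inside as well. The case \<open>z = 0\<close>
  bounds the number of zeros; the bound for \<open>cmod z \<le> R\<close> controls the growth of \<open>g\<close>.
\<close>
lemma cofactor_growth: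
  assumes g: "cofactor xs g" and R: "0 < R" and xs: "\<And>x. x \<in> set xs \<Longrightarrow> 1 / R\<^sup>2 \<le> x"
    and z: "cmod z \<le> 3 * R"
  shows "8 ^ length xs * cmod (g z) \<le> C * exp (9 * K * R\<^sup>2)"
proof -
  have gh: "g holomorphic_on UNIV" and fg: "\<And>z. f z = even_product xs z * g z"
    using g by (auto simp: cofactor_def)
  have circle: "8 ^ length xs * cmod (g w) \<le> C * exp (9 * K * R\<^sup>2)" if w: "cmod w = 3 * R" for w
  proof -
    have "8 ^ length xs \<le> cmod (even_product xs w)"
      using xs
    proof (induction xs)
      case (Cons x xs)
      have "1 / R\<^sup>2 \<le> x" using Cons.prems by simp
      then have "9 \<le> x * (3 * R)\<^sup>2" using R by (simp add: field_simps power2_eq_square)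
      moreover have "0 \<le> x" using \<open>1 / R\<^sup>2 \<le> x\<close> by (rule order_trans[rotated]) simp
      ultimately have "9 \<le> cmod (of_real x * w\<^sup>2)"
        by (simp add: norm_mult norm_power w)
      then have "8 \<le> cmod (1 + of_real x * w\<^sup>2)"
        using norm_triangle_ineq2[of "of_real x * w\<^sup>2" "- 1"] by (simp add: add.commute)
      moreover have "8 ^ length xs \<le> cmod (even_product xs w)" using Cons by simp
      ultimately have "8 * 8 ^ length xs \<le> cmod (1 + of_real x * w\<^sup>2) * cmod (even_product xs w)"
        by (intro mult_mono) auto
      then show ?case by (simp add: norm_mult)
    qed simp
    then have "8 ^ length xs * cmod (g w) \<le> cmod (even_product xs w) * cmod (g w)"
      by (intro mult_right_mono) auto
    also have "\<dots> = cmod (f w)" by (simp add: fg norm_mult)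
    also have "\<dots> \<le> C * exp (9 * K * R\<^sup>2)" using growth[of w] w by (simp add: power_mult_distrib mult_ac)
    finally show ?thesis .
  qed
  have "cmod (g z) \<le> C * exp (9 * K * R\<^sup>2) / 8 ^ length xs"
  proof (rule maximum_modulus_frontier[of g "cball 0 (3 * R)"])
    show "g holomorphic_on interior (cball 0 (3 * R))" using gh by (rule holomorphic_on_subset) simp
    show "continuous_on (closure (cball 0 (3 * R))) g"
      using gh by (intro holomorphic_on_imp_continuous_on holomorphic_on_subset[OF gh]) simp
    show "cmod (g w) \<le> C * exp (9 * K * R\<^sup>2) / 8 ^ length xs" if "w \<in> frontier (cball 0 (3 * R))" for w
      using circle[of w] that R by (simp add: field_simps frontier_cball sphere_def)
  qed (use z in auto)
  then show ?thesis by (simp add: field_simps)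
qed

text \<open>
  Zeros of modulus at most \<open>R\<close> are divided out one pair at a time. Since \<open>g 0 = 1\<close>, the growth
  bound limits the number of such steps, and a list of greatest length leaves no zero behind.
\<close>
lemma cofactor_nonvanishing_extension:
  assumes g0: "cofactor xs0 g0" and R: "0 < R" and xs0: "\<And>x. x \<in> set xs0 \<Longrightarrow> 1 / R\<^sup>2 \<le> x"
  obtains ys g where "cofactor (xs0 @ ys) g" "\<And>x. x \<in> set (xs0 @ ys) \<Longrightarrow> 1 / R\<^sup>2 \<le> x"
    "\<And>z. cmod z \<le> R \<Longrightarrow> g z \<noteq> 0"
proof -
  define P where "P n \<longleftrightarrow> (\<exists>ys g. length ys = n \<and> cofactor (xs0 @ ys) g \<and> (\<forall>x \<in> set (xs0 @ ys). 1 / R\<^sup>2 \<le> x))" for n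
  obtain N where N: "C * exp (9 * K * R\<^sup>2) < 8 ^ N"
    using real_arch_pow[of 8 "C * exp (9 * K * R\<^sup>2)"] by auto
  have "P 0" unfolding P_def using g0 xs0 by auto
  moreover have "n \<le> N" if Pn: "P n" for n
  proof (rule ccontr)
    assume "\<not> n \<le> N"
    obtain ys g where ys: "length ys = n" "cofactor (xs0 @ ys) g" "\<forall>x \<in> set (xs0 @ ys). 1 / R\<^sup>2 \<le> x"
      using Pn unfolding P_def by blast
    have "8 ^ length (xs0 @ ys) * cmod (g 0) \<le> C * exp (9 * K * R\<^sup>2)"
      using ys R by (intro cofactor_growth) auto
    moreover have "(8::real) ^ N \<le> 8 ^ length (xs0 @ ys)"
      using ys \<open>\<not> n \<le> N\<close> by (intro power_increasing) auto
    ultimately show False using N unfolding cofactor_at_0[OF ys(2)] norm_one mult_1_right by linarith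
  qed
  ultimately obtain n where n: "P n" "\<And>m. P m \<Longrightarrow> m \<le> n"
    using ex_has_greatest_nat[of P 0 "\<lambda>n. n" "Suc N"] by (auto simp: less_Suc_eq_le)
  obtain ys g where ys: "length ys = n" "cofactor (xs0 @ ys) g" "\<forall>x \<in> set (xs0 @ ys). 1 / R\<^sup>2 \<le> x"
    using n(1) unfolding P_def by blast
  have "g z \<noteq> 0" if "cmod z \<le> R" for z
  proof
    assume "g z = 0"
    then obtain x h where "cofactor ((xs0 @ ys) @ [x]) h" "1 / R\<^sup>2 \<le> x"
      using cofactor_split_zero[OF ys(2) _ \<open>cmod z \<le> R\<close>] by blast
    then have "P (Suc n)" unfolding P_def using ys
      by (intro exI[of _ "ys @ [x]"] exI[of _ h]) auto
    then show False using n(2)[of "Suc n"] by simp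
  qed
  with ys that show ?thesis by blast
qed

text \<open>
  The factor \<open>384\<close> is that of \<open>nonvanishing_eq_exp_quadratic\<close>. With \<open>C + 1\<close> in place of \<open>C\<close> the
  logarithm is positive and the bound on the cofactor strict.
\<close>
definition remainder_const :: real where "remainder_const = 384 * (ln (C + 1) + 9 * K)"

lemma remainder_const_nonneg: "0 \<le> remainder_const"
  using C_pos K_pos by (simp add: remainder_const_def)

text \<open>
  The finite form of the Hadamard factorisation, with the Gaussian factor still depending on the list.
  Starting from an arbitrary list \<open>xs0\<close> is what the next lemma needs; the approximation
  of \<open>f\<close> starts from the empty one.
\<close>
lemma finite_factorization:
  assumes g0: "cofactor xs0 g0" and R: "1 \<le> R" and xs0: "\<And>x. x \<in> set xs0 \<Longrightarrow> 1 / R\<^sup>2 \<le> x"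
  obtains ys g where "cofactor (xs0 @ ys) g" "\<And>y. y \<in> set ys \<Longrightarrow> 0 < y"
    "\<And>z. cmod z < R / 4 \<Longrightarrow> \<exists>e. f z = even_product (xs0 @ ys) z
        * exp (of_real b * z + of_real (v - sum_list (xs0 @ ys)) * z\<^sup>2 + e)
        \<and> cmod e \<le> remainder_const * cmod z ^ 3 / R"
proof -
  have "0 < R" using R by simp
  obtain ys g where g: "cofactor (xs0 @ ys) g" and ys: "\<And>x. x \<in> set (xs0 @ ys) \<Longrightarrow> 1 / R\<^sup>2 \<le> x"
    and ne: "\<And>z. cmod z \<le> R \<Longrightarrow> g z \<noteq> 0"
    using cofactor_nonvanishing_extension[OF g0 \<open>0 < R\<close> xs0] by blast
  have gh: "g holomorphic_on UNIV" and fg: "\<And>z. f z = even_product (xs0 @ ys) z * g z"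
    using g by (auto simp: cofactor_def)
  define G where "G = fps_expansion g 0"
  have G: "g has_fps_expansion G"
    unfolding G_def using gh by (intro has_fps_expansion_fps_expansion[of UNIV]) auto
  note G12 = cofactor_coeffs[OF g G]
  have ne': "g z \<noteq> 0" if "z \<in> ball 0 R" for z
    using ne[of z] that by simp
  define A where "A = ln (C + 1) + 9 * K * R\<^sup>2"
  have bound: "cmod (g z) < exp A" if "z \<in> ball 0 R" for z
  proof -
    have "1 * cmod (g z) \<le> 8 ^ length (xs0 @ ys) * cmod (g z)"
      by (intro mult_right_mono) auto
    also have "\<dots> \<le> C * exp (9 * K * R\<^sup>2)"
      using ys that R by (intro cofactor_growth[OF g]) auto
    also have "\<dots> < (C + 1) * exp (9 * K * R\<^sup>2)" by simp
    also have "\<dots> = exp A" using C_pos by (simp add: A_def exp_add)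
    finally show ?thesis by simp
  qed
  have A: "384 * A / R ^ 3 \<le> remainder_const / R"
  proof -
    have "1 \<le> R\<^sup>2" using R by (simp add: one_le_power)
    then have "ln (C + 1) * 1 \<le> ln (C + 1) * R\<^sup>2" using C_pos by (intro mult_left_mono) auto
    then have "384 * A \<le> remainder_const * R\<^sup>2" by (simp add: A_def remainder_const_def algebra_simps)
    then have "384 * A / R ^ 3 \<le> remainder_const * R\<^sup>2 / R ^ 3" using R by (intro divide_right_mono) auto
    also have "\<dots> = remainder_const / R" using R by (simp add: power2_eq_square power3_eq_cube)
    finally show ?thesis .
  qed
  have "\<exists>e. f z = even_product (xs0 @ ys) z
        * exp (of_real b * z + of_real (v - sum_list (xs0 @ ys)) * z\<^sup>2 + e)
        \<and> cmod e \<le> remainder_const * cmod z ^ 3 / R" if z: "cmod z < R / 4" for z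
  proof -
    obtain e where e: "g z = exp (fps_nth G 1 * z + (fps_nth G 2 - (fps_nth G 1)\<^sup>2 / 2) * z\<^sup>2 + e)"
      "cmod e \<le> 384 * A * cmod z ^ 3 / R ^ 3"
      using nonvanishing_eq_exp_quadratic[OF gh G cofactor_at_0[OF g] \<open>0 < R\<close> ne' bound z] by blast
    have "fps_nth G 2 - (fps_nth G 1)\<^sup>2 / 2 = of_real (v - sum_list (xs0 @ ys))"
      unfolding G12 by simp
    moreover have "384 * A * cmod z ^ 3 / R ^ 3 \<le> remainder_const * cmod z ^ 3 / R"
      using mult_right_mono[OF A, of "cmod z ^ 3"] by simp
    ultimately show ?thesis
      using e unfolding fg[of z] G12(1) by (intro exI[of _ e]) (auto simp only: intro: order_trans)
  qed
  moreover have "0 < y" if "y \<in> set ys" for y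
  proof -
    have "0 < 1 / R\<^sup>2" using R by simp
    also have "\<dots> \<le> y" using ys that by simp
    finally show ?thesis .
  qed
  ultimately show ?thesis using g that by blast
qed

text \<open>
  Fix \<open>s > 0\<close> and extend \<open>xs\<close> to a factorisation at radius \<open>R\<close>. The new factors satisfy
  \<open>1 + y s\<^sup>2 \<le> exp (y s\<^sup>2)\<close>, which cancels their contribution to the Gaussian factor; so in the limit
  \<open>R \<rightarrow> \<infinity>\<close> the value \<open>f s\<close> is at most the product over \<open>xs\<close> times \<open>exp (b s + (v - \<Sum>xs) s\<^sup>2)\<close>. Comparison
  with the lower bound \<open>exp (b s)\<close> and taking logarithms gives the fact \<open>key\<close> below, whose right-hand side
  is only logarithmic in \<open>s\<close>.
\<close>
lemma sum_list_le_half_variance: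
  assumes g0: "cofactor xs g0" and xs: "\<And>x. x \<in> set xs \<Longrightarrow> 0 < x"
  shows "sum_list xs \<le> v"
proof -
  have key: "(sum_list xs - v) * s\<^sup>2 \<le> (\<Sum>x\<leftarrow>xs. ln (1 + x * s\<^sup>2))" if s: "0 < s" for s :: real
  proof -
    have pos: "0 < (\<Prod>x\<leftarrow>zs. 1 + x * s\<^sup>2)" if "\<And>x. x \<in> set zs \<Longrightarrow> 0 < x" for zs
      using that
    proof (induction zs)
      case (Cons x zs)
      have "0 < 1 + x * s\<^sup>2" using Cons.prems[of x] by (intro add_pos_nonneg) auto
      then show ?case using Cons by simp
    qed simp
    have norm_prod: "cmod (even_product zs (of_real s)) = (\<Prod>x\<leftarrow>zs. 1 + x * s\<^sup>2)"
      if "\<And>x. x \<in> set zs \<Longrightarrow> 0 < x" for zs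
      using that
    proof (induction zs)
      case (Cons x zs)
      have "cmod (1 + of_real x * (of_real s)\<^sup>2) = cmod (of_real (1 + x * s\<^sup>2))" by simp
      also have "\<dots> = 1 + x * s\<^sup>2"
        unfolding norm_of_real using Cons.prems[of x] by (intro abs_of_nonneg) auto
      finally show ?case using Cons by (simp add: norm_mult)
    qed simp
    have prod_le: "(\<Prod>x\<leftarrow>zs. 1 + x * s\<^sup>2) \<le> exp (sum_list zs * s\<^sup>2)"
      if "\<And>x. x \<in> set zs \<Longrightarrow> 0 < x" for zs
      using that
    proof (induction zs)
      case (Cons x zs)
      have "(1 + x * s\<^sup>2) * (\<Prod>x\<leftarrow>zs. 1 + x * s\<^sup>2) \<le> exp (x * s\<^sup>2) * exp (sum_list zs * s\<^sup>2)"
        using Cons pos[of zs] by (intro mult_mono exp_ge_add_one_self) auto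
      then show ?case by (simp only: exp_add[symmetric]) (simp add: ring_distribs)
    qed simp
    \<comment> \<open>Once \<open>R \<ge> 1 / sqrt r\<close>, every entry of \<open>xs\<close> is at least \<open>1 / R\<^sup>2\<close>.\<close>
    obtain r where r: "0 < r" "\<And>x. x \<in> set xs \<Longrightarrow> r \<le> x"
    proof (cases "xs = []")
      case True
      then show ?thesis using that[of 1] by simp
    next
      case False
      then show ?thesis using that[of "Min (set xs)"] xs by simp
    qed
    have "(sum_list xs - v) * s\<^sup>2 \<le> ln (\<Prod>x\<leftarrow>xs. 1 + x * s\<^sup>2) + remainder_const * s ^ 3 / R"
      if R: "R \<ge> max (1 + 4 * s) (1 / sqrt r)" for R
    proof -
      have R1: "1 \<le> R" "s < R / 4" "0 < R" using R s by auto
      have "1 / R\<^sup>2 \<le> r"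
      proof -
        have "1 / sqrt r \<le> R" using R by simp
        then have "(1 / sqrt r)\<^sup>2 \<le> R\<^sup>2" using r by (intro power_mono) auto
        then have "1 / r \<le> R\<^sup>2" using r by (simp add: power_divide)
        then show ?thesis using r R1 by (simp add: divide_le_eq mult.commute)
      qed
      then obtain ys g where g: "cofactor (xs @ ys) g" "\<And>y. y \<in> set ys \<Longrightarrow> 0 < y"
        "\<And>z. cmod z < R / 4 \<Longrightarrow> \<exists>e. f z = even_product (xs @ ys) z
        * exp (of_real b * z + of_real (v - sum_list (xs @ ys)) * z\<^sup>2 + e)
        \<and> cmod e \<le> remainder_const * cmod z ^ 3 / R"
      proof -
        have "1 / R\<^sup>2 \<le> x" if "x \<in> set xs" for x
          using \<open>1 / R\<^sup>2 \<le> r\<close> r(2)[OF that] by simp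
        then show ?thesis using finite_factorization[OF g0 R1(1)] that by blast
      qed
      obtain e where e: "f (of_real s) = even_product (xs @ ys) (of_real s)
        * exp (of_real b * of_real s + of_real (v - sum_list (xs @ ys)) * (of_real s)\<^sup>2 + e)"
        "cmod e \<le> remainder_const * s ^ 3 / R"
        using g(3)[of "of_real s"] s R1 by auto
      define Px Py where "Px = (\<Prod>x\<leftarrow>xs. 1 + x * s\<^sup>2)" and "Py = (\<Prod>x\<leftarrow>ys. 1 + x * s\<^sup>2)"
      define q where "q = v - sum_list (xs @ ys)"
      have P: "0 < Px" "0 < Py" "Py \<le> exp (sum_list ys * s\<^sup>2)"
        unfolding Px_def Py_def using pos prod_le xs g(2) by blast+
      have norm_P: "cmod (even_product xs (of_real s)) = Px" "cmod (even_product ys (of_real s)) = Py"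
        unfolding Px_def Py_def using norm_prod xs g(2) by blast+
      have Re: "Re (of_real b * of_real s + of_real q * (of_real s)\<^sup>2 + e) = b * s + q * s\<^sup>2 + Re e"
        by (simp flip: of_real_power)
      have "exp (b * s) \<le> cmod (f (of_real s))" by (rule lower_bound)
      also have "\<dots> = Px * Py * exp (b * s + q * s\<^sup>2 + Re e)"
        unfolding e(1) q_def[symmetric] norm_mult norm_exp_eq_Re Re even_product_simps norm_P ..
      also have "\<dots> \<le> Px * exp (sum_list ys * s\<^sup>2) * exp (b * s + q * s\<^sup>2 + remainder_const * s ^ 3 / R)"
      proof (intro mult_mono mult_left_mono)
        show "exp (b * s + q * s\<^sup>2 + Re e) \<le> exp (b * s + q * s\<^sup>2 + remainder_const * s ^ 3 / R)"
          using e(2) complex_Re_le_cmod[of e] by simp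
      qed (use P in auto)
      also have "\<dots> = exp (b * s) * (Px * exp ((v - sum_list xs) * s\<^sup>2 + remainder_const * s ^ 3 / R))"
      proof -
        have "exp (sum_list ys * s\<^sup>2) * exp (b * s + q * s\<^sup>2 + remainder_const * s ^ 3 / R)
            = exp (b * s) * exp ((v - sum_list xs) * s\<^sup>2 + remainder_const * s ^ 3 / R)"
          unfolding exp_add[symmetric] q_def by (simp add: algebra_simps)
        then show ?thesis by (simp only: mult_ac)
      qed
      finally have "1 \<le> Px * exp ((v - sum_list xs) * s\<^sup>2 + remainder_const * s ^ 3 / R)"
        by simp
      then have "ln 1 \<le> ln (Px * exp ((v - sum_list xs) * s\<^sup>2 + remainder_const * s ^ 3 / R))"
        using P by (intro ln_mono) auto
      also have "\<dots> = ln Px + ((v - sum_list xs) * s\<^sup>2 + remainder_const * s ^ 3 / R)"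
        using P by (simp add: ln_mult)
      finally show ?thesis unfolding Px_def by (simp add: algebra_simps)
    qed
    then have "eventually (\<lambda>R. (sum_list xs - v) * s\<^sup>2 \<le> ln (\<Prod>x\<leftarrow>xs. 1 + x * s\<^sup>2) + remainder_const * s ^ 3 / R) at_top"
      by (rule eventually_at_top_linorderI)
    moreover have "((\<lambda>R. ln (\<Prod>x\<leftarrow>xs. 1 + x * s\<^sup>2) + remainder_const * s ^ 3 / R) \<longlongrightarrow> ln (\<Prod>x\<leftarrow>xs. 1 + x * s\<^sup>2) + 0) at_top"
      by (intro tendsto_add tendsto_const real_tendsto_divide_at_top[OF tendsto_const] filterlim_ident)
    ultimately have "(sum_list xs - v) * s\<^sup>2 \<le> ln (\<Prod>x\<leftarrow>xs. 1 + x * s\<^sup>2) + 0"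
      by (intro tendsto_lowerbound) auto
    also have "ln (\<Prod>x\<leftarrow>xs. 1 + x * s\<^sup>2) = (\<Sum>x\<leftarrow>xs. ln (1 + x * s\<^sup>2))"
      using xs
    proof (induction xs)
      case (Cons x xs)
      have "0 < 1 + x * s\<^sup>2" using Cons.prems[of x] by (intro add_pos_nonneg) auto
      then show ?case using Cons pos[of xs] by (simp add: ln_mult)
    qed simp
    finally show ?thesis by simp
  qed
  have "((\<lambda>s. (\<Sum>x\<leftarrow>xs. ln (1 + x * s\<^sup>2)) / s\<^sup>2) \<longlongrightarrow> 0) at_top"
    using xs
  proof (induction xs)
    case (Cons x xs)
    have "0 < x" using Cons by simp
    then have "((\<lambda>s. ln (1 + x * s\<^sup>2) / s\<^sup>2) \<longlongrightarrow> 0) at_top" by real_asymp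
    from tendsto_add[OF this Cons.IH] Cons.prems show ?case by (simp add: add_divide_distrib)
  qed simp
  moreover have "eventually (\<lambda>s. sum_list xs - v \<le> (\<Sum>x\<leftarrow>xs. ln (1 + x * s\<^sup>2)) / s\<^sup>2) at_top"
    using eventually_gt_at_top[of 0] by eventually_elim (use key in \<open>simp add: field_simps\<close>)
  ultimately have "sum_list xs - v \<le> 0" by (intro tendsto_lowerbound) auto
  then show ?thesis by simp
qed

end


section \<open>Approximation by finite products\<close>

lemma norm_exp_minus_one_le:
  fixes w :: complex
  shows "cmod (exp w - 1) \<le> exp (cmod w) - 1"
proof -
  have a: "(\<lambda>n. w ^ Suc n /\<^sub>R fact (Suc n)) sums (exp w - 1)"
    using sums_Suc_iff[of "\<lambda>n. w ^ n /\<^sub>R fact n" "exp w - 1"] exp_converges[of w] by simp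
  have b: "(\<lambda>n. cmod w ^ Suc n /\<^sub>R fact (Suc n)) sums (exp (cmod w) - 1)"
    using sums_Suc_iff[of "\<lambda>n. cmod w ^ n /\<^sub>R fact n" "exp (cmod w) - 1"] exp_converges[of "cmod w"] by simp
  have "cmod (\<Sum>n. w ^ Suc n /\<^sub>R fact (Suc n)) \<le> (\<Sum>n. cmod w ^ Suc n /\<^sub>R fact (Suc n))"
    by (rule norm_suminf_le[OF _ sums_summable[OF b]])
       (simp add: norm_mult norm_power del: fact_Suc power_Suc)
  then show ?thesis using a b by (simp add: sums_iff)
qed

text \<open>
  A multiplicative form of \<open>(1 + w / m)\<^sup>m \<rightarrow> exp w\<close> with an explicit rate: the error \<open>e\<close> is
  \<open>m\<close> times the quadratic remainder of the logarithm at \<open>w / m\<close>.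
\<close>
lemma exp_eq_power_times_exp:
  fixes w :: complex
  assumes m: "0 < m" "2 * cmod w \<le> real m"
  obtains e where "exp w = (1 + w / of_nat m) ^ m * exp e" "cmod e \<le> 2 * (cmod w)\<^sup>2 / real m"
proof -
  define u where "u = w / of_nat m"
  have u: "cmod u \<le> 1 / 2" using m by (simp add: u_def norm_divide field_simps)
  have "1 + u \<noteq> 0"
  proof
    assume "1 + u = 0"
    then have "u = - 1" by (simp add: add_eq_0_iff)
    then show False using u by simp
  qed
  define e where "e = of_nat m * (u - Ln (1 + u))"
  have "exp (of_nat m * Ln (1 + u)) = (1 + u) ^ m"
    using \<open>1 + u \<noteq> 0\<close> by (simp add: exp_of_nat_mult)
  moreover have "w = of_nat m * Ln (1 + u) + e"
    using m by (simp add: e_def u_def algebra_simps)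
  ultimately have "exp w = (1 + w / of_nat m) ^ m * exp e"
    by (metis exp_add u_def)
  moreover have "cmod e \<le> 2 * (cmod w)\<^sup>2 / real m"
  proof -
    have "cmod (Ln (1 + u) - u) \<le> (cmod u)\<^sup>2 / (1 - cmod u)"
      using u by (intro Ln_approx_linear) linarith
    also have "\<dots> \<le> (cmod u)\<^sup>2 / (1 / 2)" using u by (intro divide_left_mono) auto
    finally have "cmod (u - Ln (1 + u)) \<le> 2 * (cmod u)\<^sup>2" by (simp add: norm_minus_commute)
    then have "cmod e \<le> real m * (2 * (cmod u)\<^sup>2)" unfolding e_def norm_mult by (intro mult_mono) auto
    also have "\<dots> = 2 * (cmod w)\<^sup>2 / real m"
      using m by (simp add: u_def norm_divide power2_eq_square)
    finally show ?thesis .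
  qed
  ultimately show ?thesis using that by blast
qed

lemma even_product_replicate: "even_product (replicate m x) z = (1 + of_real x * z\<^sup>2) ^ m"
  by (induction m) auto

context imaginary_zeros_entire
begin

text \<open>
  In the factorisation at radius \<open>R\<close> the factor \<open>exp (q z\<^sup>2)\<close> with \<open>0 \<le> q \<le> v\<close> is replaced by
  \<open>m\<close> equal factors \<open>1 + (q / m) z\<^sup>2\<close>. The bound \<open>q \<le> v\<close>, uniform in \<open>R\<close>, keeps the cost of this step
  of order \<open>1 / m\<close>.
\<close>
lemma approximation_on_unit_circle:
  obtains xs where "\<And>x. x \<in> set xs \<Longrightarrow> 0 \<le> x"
    "\<And>z. cmod z = 1 \<Longrightarrow> \<exists>e. f z = even_product xs z * exp (of_real b * z) * exp e
        \<and> cmod e \<le> (remainder_const + 2 * v\<^sup>2) / real (Suc n)"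
proof -
  \<comment> \<open>Any multiple of \<open>n + 1\<close> that keeps the unit circle inside the ball of radius \<open>R / 4\<close> will do.\<close>
  define R where "R = 8 * real (Suc n)"
  have R: "1 \<le> R" "1 < R / 4" by (auto simp: R_def)
  obtain ys g where g: "cofactor ys g" and ys: "\<And>y. y \<in> set ys \<Longrightarrow> 0 < y" and
    appr: "\<And>z. cmod z < R / 4 \<Longrightarrow> \<exists>e. f z = even_product ys z
        * exp (of_real b * z + of_real (v - sum_list ys) * z\<^sup>2 + e)
        \<and> cmod e \<le> remainder_const * cmod z ^ 3 / R"
    using finite_factorization[OF cofactor_Nil R(1)] by auto
  define q where "q = v - sum_list ys"
  have "0 \<le> sum_list ys" using ys by (intro sum_list_nonneg less_imp_le)
  then have q: "0 \<le> q" "q \<le> v"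
    using sum_list_le_half_variance[OF g ys] by (auto simp: q_def)
  define m where "m = Suc n + nat \<lceil>2 * v\<rceil>"
  have m: "0 < m" "2 * v \<le> real m" "real (Suc n) \<le> real m"
    by (auto simp: m_def) linarith
  define xs where "xs = ys @ replicate m (q / real m)"
  show ?thesis
  proof (rule that[of xs])
    show "0 \<le> x" if "x \<in> set xs" for x
      using that ys q by (auto simp: xs_def intro: less_imp_le)
    fix z :: complex assume z: "cmod z = 1"
    obtain e1 where e1: "f z = even_product ys z * exp (of_real b * z + of_real q * z\<^sup>2 + e1)"
      "cmod e1 \<le> remainder_const / R"
      using appr[of z] z R unfolding q_def by auto
    have nq: "cmod (of_real q * z\<^sup>2) = q" using q z by (simp add: norm_mult norm_power)
    obtain e2 where e2: "exp (of_real q * z\<^sup>2) = (1 + of_real q * z\<^sup>2 / of_nat m) ^ m * exp e2"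
      "cmod e2 \<le> 2 * q\<^sup>2 / real m"
      using exp_eq_power_times_exp[of m "of_real q * z\<^sup>2"] m q unfolding nq by force
    have "even_product xs z = even_product ys z * (1 + of_real q * z\<^sup>2 / of_nat m) ^ m"
      by (simp add: xs_def even_product_replicate)
    then have "f z = even_product xs z * exp (of_real b * z) * exp (e1 + e2)"
      unfolding e1 exp_add e2 by simp
    moreover have "cmod (e1 + e2) \<le> (remainder_const + 2 * v\<^sup>2) / real (Suc n)"
    proof -
      have "remainder_const / R \<le> remainder_const / real (Suc n)"
        using remainder_const_nonneg by (intro divide_left_mono) (auto simp: R_def)
      moreover have "2 * q\<^sup>2 / real m \<le> 2 * v\<^sup>2 / real (Suc n)"
        using q m by (intro frac_le mult_left_mono power_mono) auto
      ultimately show ?thesis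
        using norm_triangle_ineq[of e1 e2] e1(2) e2(2) by (simp add: add_divide_distrib)
    qed
    ultimately show "\<exists>e. f z = even_product xs z * exp (of_real b * z) * exp e
        \<and> cmod e \<le> (remainder_const + 2 * v\<^sup>2) / real (Suc n)" by blast
  qed
qed

lemma strongly_log_concave_coeffs:
  "strongly_log_concave (\<lambda>k. fact k * Re (fps_nth F (2 * k)))"
proof -
  define D where "D = remainder_const + 2 * v\<^sup>2"
  define P where "P n xs \<longleftrightarrow> (\<forall>x \<in> set xs. 0 \<le> x) \<and> (\<forall>z. cmod z = 1 \<longrightarrow>
      (\<exists>e. f z = even_product xs z * exp (of_real b * z) * exp e \<and> cmod e \<le> D / real (Suc n)))" for n xs
  have "\<exists>xs. P n xs" for n
  proof -
    show ?thesis
    proof (rule approximation_on_unit_circle[where n = n], rule exI)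
      fix xs
      assume "\<And>x. x \<in> set xs \<Longrightarrow> 0 \<le> x"
        "\<And>z. cmod z = 1 \<Longrightarrow> \<exists>e. f z = even_product xs z * exp (of_real b * z) * exp e
          \<and> cmod e \<le> (remainder_const + 2 * v\<^sup>2) / real (Suc n)"
      then show "P n xs" unfolding P_def D_def by blast
    qed
  qed
  then obtain xs where xs: "\<And>n. P n (xs n)" using choice[of P] by blast
  have nonneg: "0 \<le> x" if "x \<in> set (xs n)" for n x
    using xs[of n] that unfolding P_def by blast
  define g where "g n z = even_product (xs n) z * exp (of_real b * z)" for n z
  define d where "d n = C * exp K * (exp (D / real (Suc n)) - 1)" for n
  have "(\<lambda>n. fps_nth (even_product_fps (xs n) * fps_exp (of_real b)) k) \<longlonglongrightarrow> fps_nth F k" for k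
  proof (rule fps_nth_tendsto_of_uniform_limit)
    show "g n holomorphic_on UNIV" for n unfolding g_def by (intro holomorphic_intros)
    show "g n has_fps_expansion even_product_fps (xs n) * fps_exp (of_real b)" for n
      unfolding g_def by (intro fps_expansion_intros has_fps_expansion_even_product)
    show "d \<longlonglongrightarrow> 0"
    proof -
      have "(\<lambda>n. D / real (Suc n)) \<longlonglongrightarrow> 0" using LIMSEQ_Suc[OF lim_const_over_n[of D]] by simp
      from tendsto_diff[OF tendsto_exp[OF this] tendsto_const[of 1]]
      have "(\<lambda>n. exp (D / real (Suc n)) - 1) \<longlonglongrightarrow> 0" by simp
      then show ?thesis unfolding d_def by (rule tendsto_mult_right_zero)
    qed
    show "cmod (g n z - f z) \<le> d n" if z: "cmod z = 1" for n z
    proof -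
      obtain e where e: "f z = g n z * exp e" "cmod e \<le> D / real (Suc n)"
        using xs[of n] z unfolding g_def P_def by blast
      have "f z * exp (- e) = g n z" unfolding e(1) by (simp add: exp_minus)
      then have "g n z - f z = f z * (exp (- e) - 1)" by (simp add: right_diff_distrib)
      then have "cmod (g n z - f z) = cmod (f z) * cmod (exp (- e) - 1)" by (simp add: norm_mult)
      also have "\<dots> \<le> (C * exp K) * (exp (D / real (Suc n)) - 1)"
      proof (rule mult_mono)
        show "cmod (f z) \<le> C * exp K" using growth[of z] z by simp
        have "cmod (exp (- e) - 1) \<le> exp (cmod (- e)) - 1" by (rule norm_exp_minus_one_le)
        also have "\<dots> \<le> exp (D / real (Suc n)) - 1" using e(2) by simp
        finally show "cmod (exp (- e) - 1) \<le> exp (D / real (Suc n)) - 1" .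
      qed (use C_pos in auto)
      finally show ?thesis unfolding d_def .
    qed
  qed (rule holomorphic expansion)+
  then show ?thesis
    by (intro strongly_log_concave_limit[OF strongly_log_concave_even_coeffs[OF nonneg]]
        tendsto_mult_left tendsto_Re)
qed

end


section \<open>Moments of random variables of type \<open>\<L>'\<close>\<close>

context prob_space
begin

lemma integrable_exp_abs:
  fixes X :: "'a \<Rightarrow> real"
  assumes X: "X \<in> borel_measurable M"
    and int: "\<And>s. integrable M (\<lambda>\<omega>. exp (s * X \<omega>))"
  shows "integrable M (\<lambda>\<omega>. exp (s * \<bar>X \<omega>\<bar>))"
proof (rule Bochner_Integration.integrable_bound)
  show "integrable M (\<lambda>\<omega>. exp (s * X \<omega>) + exp ((- s) * X \<omega>))" by (intro Bochner_Integration.integrable_add int)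
  show "(\<lambda>\<omega>. exp (s * \<bar>X \<omega>\<bar>)) \<in> borel_measurable M" using X by measurable
  have "exp (s * \<bar>x\<bar>) \<le> exp (s * x) + exp ((- s) * x)" for x by (cases "0 \<le> x") auto
  then show "AE \<omega> in M. norm (exp (s * \<bar>X \<omega>\<bar>)) \<le> norm (exp (s * X \<omega>) + exp ((- s) * X \<omega>))"
    by (intro AE_I2) (smt (verit) exp_gt_zero real_norm_def)
qed

lemma integrable_moment:
  fixes X :: "'a \<Rightarrow> real"
  assumes X: "X \<in> borel_measurable M"
    and int: "\<And>s. integrable M (\<lambda>\<omega>. exp (s * X \<omega>))"
  shows "integrable M (\<lambda>\<omega>. X \<omega> ^ k)"
proof (rule Bochner_Integration.integrable_bound)
  show "integrable M (\<lambda>\<omega>. fact k * exp (1 * \<bar>X \<omega>\<bar>))"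
    by (intro integrable_mult_right integrable_exp_abs X int)
  show "(\<lambda>\<omega>. X \<omega> ^ k) \<in> borel_measurable M" using X by measurable
  have "\<bar>x\<bar> ^ k \<le> fact k * exp \<bar>x\<bar>" for x :: real
  proof -
    have "\<bar>x\<bar> ^ k /\<^sub>R fact k \<le> exp \<bar>x\<bar>"
      using sum_le_suminf[OF summable_exp_generic[of "\<bar>x\<bar>"], of "{k}"]
      by (simp add: exp_def)
    then show ?thesis by (simp add: field_simps)
  qed
  then show "AE \<omega> in M. norm (X \<omega> ^ k) \<le> norm (fact k * exp (1 * \<bar>X \<omega>\<bar>))"
    by (intro AE_I2) (simp add: power_abs)
qed

text \<open>
  Term-by-term integration of the exponential series, dominated by \<open>exp (cmod z * \<bar>X\<bar>)\<close>. It shows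
  that the moment generating function is entire and identifies its coefficients.
\<close>
lemma complex_mgf_sums:
  fixes X :: "'a \<Rightarrow> real"
  assumes X: "X \<in> borel_measurable M"
    and int: "\<And>s. integrable M (\<lambda>\<omega>. exp (s * X \<omega>))"
  shows "(\<lambda>k. of_real (expectation (\<lambda>\<omega>. X \<omega> ^ k) / fact k) * z ^ k) sums complex_mgf M X z"
proof -
  define t where "t k \<omega> = (z * of_real (X \<omega>)) ^ k /\<^sub>R fact k" for k \<omega>
  have t_eq: "t k \<omega> = (z ^ k / fact k) * of_real (X \<omega> ^ k)" for k \<omega>
    by (simp add: t_def scaleR_conv_of_real power_mult_distrib field_simps)
  have nt_eq: "norm (t k \<omega>) = (cmod z * \<bar>X \<omega>\<bar>) ^ k /\<^sub>R fact k" for k \<omega>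
    by (simp add: t_def norm_mult norm_power)
  have ti: "integrable M (t k)" for k
    unfolding t_eq by (intro integrable_mult_right integrable_of_real integrable_moment X int)
  have "(\<lambda>k. integral\<^sup>L M (t k)) sums (\<integral>\<omega>. (\<Sum>k. t k \<omega>) \<partial>M)"
  proof (rule sums_integral)
    show "AE \<omega> in M. summable (\<lambda>k. norm (t k \<omega>))"
      unfolding nt_eq by (intro AE_I2 summable_exp_generic)
    show "summable (\<lambda>k. \<integral>\<omega>. norm (t k \<omega>) \<partial>M)"
    proof (rule summableI_nonneg_bounded)
      fix n
      have "(\<Sum>k<n. \<integral>\<omega>. norm (t k \<omega>) \<partial>M) = (\<integral>\<omega>. (\<Sum>k<n. norm (t k \<omega>)) \<partial>M)"
        by (intro Bochner_Integration.integral_sum[symmetric] integrable_norm ti)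
      also have "\<dots> \<le> (\<integral>\<omega>. exp (cmod z * \<bar>X \<omega>\<bar>) \<partial>M)"
      proof (intro integral_mono integrable_exp_abs X int Bochner_Integration.integrable_sum integrable_norm ti)
        show "(\<Sum>k<n. norm (t k \<omega>)) \<le> exp (cmod z * \<bar>X \<omega>\<bar>)" for \<omega>
          unfolding nt_eq exp_def by (intro sum_le_suminf summable_exp_generic) auto
      qed
      finally show "(\<Sum>k<n. \<integral>\<omega>. norm (t k \<omega>) \<partial>M) \<le> (\<integral>\<omega>. exp (cmod z * \<bar>X \<omega>\<bar>) \<partial>M)" .
    qed simp
  qed (rule ti)
  moreover have "(\<integral>\<omega>. (\<Sum>k. t k \<omega>) \<partial>M) = complex_mgf M X z"
    unfolding complex_mgf_def t_def exp_def ..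
  moreover have "integral\<^sup>L M (t k) = of_real (expectation (\<lambda>\<omega>. X \<omega> ^ k) / fact k) * z ^ k" for k
    unfolding t_eq using integral_complex_of_real[of M "\<lambda>\<omega>. X \<omega> ^ k"] by simp
  ultimately show ?thesis by simp
qed

lemma type_L'_even_moments_log_concave:
  fixes X :: "'a \<Rightarrow> real"
  assumes "type_L' M X"
  shows "strongly_log_concave (\<lambda>k. fact k / fact (2 * k) * expectation (\<lambda>\<omega>. X \<omega> ^ (2 * k)))"
proof -
  have X: "X \<in> borel_measurable M"
    and cint: "\<And>z. integrable M (\<lambda>\<omega>. exp (z * complex_of_real (X \<omega>)))"
    and zeros: "\<And>z. complex_mgf M X z = 0 \<Longrightarrow> Re z = 0"
    using assms by (auto simp: type_L'_def)
  obtain C K where CK: "C > 0" "K > 0" "\<And>z. cmod (complex_mgf M X z) \<le> C * exp (K * (cmod z)\<^sup>2)"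
    using assms by (auto simp: type_L'_def)
  have int: "integrable M (\<lambda>\<omega>. exp (s * X \<omega>))" for s
    using integrable_norm[OF cint[of "of_real s"]] by (simp add: norm_exp_eq_Re)
  note moment = integrable_moment[OF X int]
  define F where "F = Abs_fps (\<lambda>k. complex_of_real (expectation (\<lambda>\<omega>. X \<omega> ^ k) / fact k))"
  note sums = complex_mgf_sums[OF X int]
  define b where "b = expectation X"
  define v where "v = (expectation (\<lambda>\<omega>. X \<omega> ^ 2) - b\<^sup>2) / 2"
  interpret imaginary_zeros_entire "complex_mgf M X" F b v C K
  proof
    have "complex_mgf M X holomorphic_on ball 0 r" for r
      by (rule power_series_holomorphic[where a = "\<lambda>k. of_real (expectation (\<lambda>\<omega>. X \<omega> ^ k) / fact k)"])
         (use sums in simp)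
    then have "complex_mgf M X analytic_on {z}" for z
      unfolding analytic_at by (intro exI[of _ "ball 0 (cmod z + 1)"]) auto
    then have "complex_mgf M X analytic_on UNIV" unfolding analytic_on_analytic_at[of _ UNIV] by simp
    then show "complex_mgf M X holomorphic_on UNIV" by (rule analytic_imp_holomorphic)
    show "complex_mgf M X has_fps_expansion F"
      by (rule has_fps_expansionI) (use sums in \<open>simp add: F_def\<close>)
    show "complex_mgf M X 0 = 1" by (simp add: complex_mgf_def prob_space)
    show "complex_mgf M X (cnj z) = cnj (complex_mgf M X z)" for z
      using integral_bounded_linear[OF bounded_linear_cnj cint[of z]]
      by (simp add: complex_mgf_def exp_cnj)
    show "fps_nth F 1 = of_real b" by (simp add: F_def b_def)
    show "fps_nth F 2 = of_real (v + b\<^sup>2 / 2)" by (simp add: F_def v_def diff_divide_distrib)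
    show "exp (b * s) \<le> cmod (complex_mgf M X (of_real s))" for s
    proof -
      have "complex_mgf M X (of_real s) = of_real (expectation (\<lambda>\<omega>. exp (s * X \<omega>)))"
        unfolding complex_mgf_def by (simp add: exp_of_real flip: of_real_mult)
      moreover have "exp (b * s) \<le> expectation (\<lambda>\<omega>. exp (s * X \<omega>))"
      proof -
        have Xi: "integrable M X" using moment[of 1] by simp
        \<comment> \<open>The tangent line of \<open>exp\<close> at \<open>b s\<close> integrates to its value there.\<close>
        have "exp (b * s) = expectation (\<lambda>\<omega>. exp (b * s) * (1 + s * X \<omega> - b * s))"
          using Xi by (simp add: prob_space b_def algebra_simps)
        also have "\<dots> \<le> expectation (\<lambda>\<omega>. exp (s * X \<omega>))"
        proof (rule integral_mono)
          show "integrable M (\<lambda>\<omega>. exp (b * s) * (1 + s * X \<omega> - b * s))" using Xi by simp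
          show "exp (b * s) * (1 + s * X \<omega> - b * s) \<le> exp (s * X \<omega>)" for \<omega>
          proof -
            have "exp (b * s) * (1 + (s * X \<omega> - b * s)) \<le> exp (b * s) * exp (s * X \<omega> - b * s)"
              by (intro mult_left_mono exp_ge_add_one_self) simp
            then show ?thesis by (simp add: exp_diff algebra_simps)
          qed
        qed (rule int)
        finally show ?thesis .
      qed
      ultimately show ?thesis by simp
    qed
  qed (use CK zeros in auto)
  have "fact k * Re (fps_nth F (2 * k)) = fact k / fact (2 * k) * expectation (\<lambda>\<omega>. X \<omega> ^ (2 * k))" for k
  proof -
    have "Re (fps_nth F (2 * k)) = expectation (\<lambda>\<omega>. X \<omega> ^ (2 * k)) / fact (2 * k)"
      unfolding F_def fps_nth_Abs_fps Re_complex_of_real ..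
    then show ?thesis by simp
  qed
  then show ?thesis using strongly_log_concave_coeffs by simp
qed

end

lemma Lp_norm_even:
  fixes Y :: "'a \<Rightarrow> real"
  assumes "0 < m"
  shows "Lp_norm M (real (2 * m)) Y = (LINT \<omega>|M. Y \<omega> ^ (2 * m)) powr (1 / real (2 * m))"
proof -
  have "\<bar>y\<bar> powr real (2 * m) = y ^ (2 * m)" for y :: real
  proof -
    have "\<bar>y\<bar> powr real (2 * m) = \<bar>y\<bar> ^ (2 * m)"
      using assms by (intro powr_realpow') auto
    then show ?thesis by (simp only: power_even_abs even_mult_iff even_numeral simp_thms)
  qed
  then show ?thesis unfolding Lp_norm_def by simp
qed

lemma std_normal_even_moment:
  assumes "distributed N lborel G std_normal_density"
  shows "(LINT \<omega>|N. G \<omega> ^ (2 * m)) = fact (2 * m) / (2 ^ m * fact m)"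
  using distributed_integral[OF assms, of "\<lambda>x. x ^ (2 * m)"]
    has_bochner_integral_integral_eq[OF std_normal_moment_even[of m]] by simp

text \<open>
  With \<open>c\<close> as above, \<open>\<parallel>X\<parallel>\<^sub>2\<^sub>k\<close> is \<open>\<parallel>G\<parallel>\<^sub>2\<^sub>k\<close> times the square root of \<open>2 (c k)\<^sup>1\<^sup>/\<^sup>k\<close>, so the inequality
  compares \<open>(c n)\<^sup>1\<^sup>/\<^sup>n\<close> with \<open>(c m)\<^sup>1\<^sup>/\<^sup>m\<close> for \<open>p = 2 m\<close> and \<open>q = 2 n\<close>.
\<close>
theorem theorem1:
  fixes M :: "'a measure" and X :: "'a \<Rightarrow> real"
    and N :: "'b measure" and G :: "'b \<Rightarrow> real"
    and p q :: nat
  assumes "prob_space M" and "type_L' M X"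
    and "prob_space N" and "distributed N lborel G std_normal_density"
    and "even p" and "even q" and "2 \<le> p" and "p \<le> q"
  shows "Lp_norm M q X \<le> Lp_norm N q G / Lp_norm N p G * Lp_norm M p X"
proof -
  interpret prob_space M by fact
  obtain m n where mn: "p = 2 * m" "q = 2 * n" using \<open>even p\<close> \<open>even q\<close> by (auto elim!: evenE)
  with \<open>2 \<le> p\<close> \<open>p \<le> q\<close> have m: "1 \<le> m" "m \<le> n" by auto
  define c where "c k = fact k / fact (2 * k) * expectation (\<lambda>\<omega>. X \<omega> ^ (2 * k))" for k
  have c: "strongly_log_concave c"
    unfolding c_def by (rule type_L'_even_moments_log_concave) fact
  have c0: "c 0 = 1" by (simp add: c_def prob_space)
  have le: "c n powr (1 / n) \<le> c m powr (1 / m)"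
    by (rule strongly_log_concave_root_antimono[OF c c0 m])
  have ratio: "Lp_norm M (2 * k) X = Lp_norm N (2 * k) G * (sqrt 2 * (c k powr (1 / k)) powr (1 / 2))"
    and pos: "0 < Lp_norm N (2 * k) G" if k: "0 < k" for k :: nat
  proof -
    define \<gamma> :: real where "\<gamma> = fact (2 * k) / (2 ^ k * fact k)"
    have G: "Lp_norm N (2 * k) G = \<gamma> powr (1 / (2 * k))"
      unfolding Lp_norm_even[OF k] std_normal_even_moment[OF assms(4)] \<gamma>_def ..
    have \<gamma>: "0 < \<gamma>" by (simp add: \<gamma>_def)
    then show "0 < Lp_norm N (2 * k) G" unfolding G by simp
    have "expectation (\<lambda>\<omega>. X \<omega> ^ (2 * k)) = \<gamma> * (2 ^ k * c k)"
      by (simp add: \<gamma>_def c_def)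
    then have "Lp_norm M (2 * k) X = \<gamma> powr (1 / (2 * k)) * ((2 ^ k) powr (1 / (2 * k)) * c k powr (1 / (2 * k)))"
      unfolding Lp_norm_even[OF k] using \<gamma> strongly_log_concaveD(1)[OF c, of k]
      by (simp only: powr_mult)
    also have "(2 ^ k) powr (1 / (2 * k)) = sqrt 2"
    proof -
      have "(2 ^ k) powr (1 / (2 * k)) = (2 powr real k) powr (1 / (2 * k))"
        by (simp only: powr_realpow zero_less_numeral)
      also have "\<dots> = 2 powr (1 / 2)" using k by (simp add: powr_powr)
      finally show ?thesis by (simp only: powr_half_sqrt zero_le_numeral)
    qed
    also have "c k powr (1 / (2 * k)) = (c k powr (1 / k)) powr (1 / 2)"
      by (simp add: powr_powr mult.commute)
    finally show "Lp_norm M (2 * k) X = Lp_norm N (2 * k) G * (sqrt 2 * (c k powr (1 / k)) powr (1 / 2))"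
      unfolding G .
  qed
  have "(c n powr (1 / n)) powr (1 / 2) \<le> (c m powr (1 / m)) powr (1 / 2)"
    by (intro powr_mono2 le) auto
  then have "Lp_norm M (2 * n) X \<le> Lp_norm N (2 * n) G * (sqrt 2 * (c m powr (1 / m)) powr (1 / 2))"
    using ratio[of n] pos[of n] m by (simp add: mult_left_mono)
  also have "\<dots> = Lp_norm N (2 * n) G / Lp_norm N (2 * m) G * Lp_norm M (2 * m) X"
    using ratio[of m] pos[of m] m by simp
  finally show ?thesis unfolding mn .
qed

end
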